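(* Let $(X,d)$ be a proper Hadamard space, $(V,\mathcal V)$ a measurable space, and $(T_v)_{v\in V}$ a family of nonexpansive mappings $T_v:X\to X$ (i.e. $d(T_vx,T_vy)\le d(x,y)$ for all $x,y\in X$, $v\in V$) such that $V\times X\to X$, $(v,x)\mapsto T_vx$, is $\mathcal V\otimes\mathcal B(X)/\mathcal B(X)$-measurable. Let $v$ be a $V$-valued random variable on a probability space $(\Omega,\mathsf F,\mathbb P)$, and define $$F:=\{z\in X\mid T_vz=z\ \ \mathbb P\text{-a.s.}\}.$$ Assume $F\ne\emptyset$. Let $x_0\in X$, fix some $p\in F$ and $c\ge1$ with $d(x_0,p)\le c$, and set $X_0:=\overline B_c(p)$ (the closed ball). Define $$x_{n+1}:=(1-\lambda_n)x_n\oplus\lambda_nT_{v_n}x_n,$$ where $(\lambda_n)\subset(0,1]$ with $\sum_{n=0}^\infty\lambda_n(1-\lambda_n)=\infty$, and $(v_n)$ is a sequence of independent $V$-valued random variables on $\Omega$ distributed as $v$. Then there is an $X$-valued random variable $x$ with $x_n\to x$ almost surely and $x\in F$ almost surely. Furthermore, if $\gamma:\mathbb N\to\mathbb N$ is a modulus of total boundedness for $X_0$ and $\theta:\mathbb N\times(0,\infty)\to\mathbb N$ is a rate of divergence for $\sum_{n=0}^\infty\lambda_n(1-\lambda_n)$, then a rate of metastability for $(x_n)$ is explicitly definable in those data, i.e. there is a single explicit construction $(c,\gamma,\theta)\mapsto\Delta_{c,\gamma,\theta}$, depending on nothing else (in particular not on $X$, the probability space, $v$, $(T_v)$, $x_0$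 or $p$), such that $\Delta=\Delta_{c,\gamma,\theta}$ satisfies, for all $\lambda>0$, $k\in\mathbb N$ and $g:\mathbb N\to\mathbb N$, $$\mathbb P\Big(\forall n\le\Delta(\lambda,k,g)\ \exists i,j\in[n;n+g(n)]\ \big(d(x_i,x_j)>\tfrac1{k+1}\big)\Big)<\lambda .$$
   Context: A Hadamard space is a complete $\mathrm{CAT}(0)$ space, i.e. a complete uniquely geodesic metric space satisfying $d^2((1-\lambda)x\oplus\lambda y,z)\le(1-\lambda)d^2(x,z)+\lambda d^2(y,z)-\lambda(1-\lambda)d^2(x,y)$ for all $x,y,z\in X$, $\lambda\in[0,1]$, where $(1-\lambda)x\oplus\lambda y$ is the unique point $w$ on the geodesic joining $x$ and $y$ with $d(x,w)=\lambda d(x,y)$ and $d(y,w)=(1-\lambda)d(x,y)$. Proper means closed balls are compact. $\mathcal B(X)$ is the Borel $\sigma$-algebra. $[n;m]:=[n,m]\cap\mathbb N$. Modulus of total boundedness for $A\subseteq X$: a function $\gamma:\mathbb N\to\mathbb N$ such that for all $k$ and every sequence $(y_n)\subseteq A$ there are $0\le i<j\le\gamma(k)$ with $d(y_i,y_j)\le\frac1{k+1}$. Rate of divergence for $\sum_n\lambda_n(1-\lambda_n)$: a function $\theta:\mathbb N\times(0,\infty)\to\mathbb N$ with $\sum_{n=N}^{\theta(N,b)}\lambda_n(1-\lambda_n)\ge b$ for all $N\in\mathbb N$, $b>0$. *)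

theory Defs
  imports "HOL-Probability.Probability"
begin

definition is_geodesic :: "'a::metric_space \<Rightarrow> 'a \<Rightarrow> (real \<Rightarrow> 'a) \<Rightarrow> bool" where
  "is_geodesic x y \<sigma> \<longleftrightarrow> \<sigma> 0 = x \<and> \<sigma> (dist x y) = y \<and>
     (\<forall>s\<in>{0..dist x y}. \<forall>t\<in>{0..dist x y}. dist (\<sigma> s) (\<sigma> t) = \<bar>s - t\<bar>)"

text \<open>\<open>geo_comb l x y\<close> is the point \<open>(1 - l) x \<oplus> l y\<close>: weight \<open>l\<close> goes to the
  last argument.  It is well defined in a uniquely geodesic space, for \<open>0 \<le> l \<le> 1\<close>.\<close>

definition geo_comb :: "real \<Rightarrow> 'a::metric_space \<Rightarrow> 'a \<Rightarrow> 'a" where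
  "geo_comb l x y = (THE w. (\<exists>\<sigma>. is_geodesic x y \<sigma> \<and> w \<in> \<sigma> ` {0..dist x y}) \<and>
     dist x w = l * dist x y \<and> dist y w = (1 - l) * dist x y)"

text \<open>In \<open>geodesic_unique\<close>, geodesics are compared only on \<open>[0, d(x,y)]\<close>, since their values
  outside this interval are irrelevant.\<close>

class hadamard_space = complete_space +
  assumes geodesic_exists: "\<exists>\<sigma>. is_geodesic x y \<sigma>"
    and geodesic_unique: "is_geodesic x y \<sigma> \<Longrightarrow> is_geodesic x y \<tau> \<Longrightarrow>
      t \<in> {0..dist x y} \<Longrightarrow> \<sigma> t = \<tau> t"
    and CAT0_inequality: "0 \<le> l \<Longrightarrow> l \<le> 1 \<Longrightarrow>
      (dist (geo_comb l x y) z)\<^sup>2 \<le>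
        (1 - l) * (dist x z)\<^sup>2 + l * (dist y z)\<^sup>2 - l * (1 - l) * (dist x y)\<^sup>2"

class proper_hadamard_space = hadamard_space +
  assumes compact_cball_proper: "compact (cball x r)"

definition random_fixed_points ::
    "'o measure \<Rightarrow> ('v \<Rightarrow> 'a \<Rightarrow> 'a) \<Rightarrow> ('o \<Rightarrow> 'v) \<Rightarrow> 'a set" where
  "random_fixed_points M T v = {z. AE \<omega> in M. T (v \<omega>) z = z}"

primrec random_KM ::
    "('v \<Rightarrow> 'a \<Rightarrow> 'a) \<Rightarrow> (nat \<Rightarrow> 'o \<Rightarrow> 'v) \<Rightarrow> (nat \<Rightarrow> real) \<Rightarrow> 'a::metric_space \<Rightarrow> nat \<Rightarrow> 'o \<Rightarrow> 'a" where
  "random_KM T vs lam x0 0 \<omega> = x0"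
| "random_KM T vs lam x0 (Suc n) \<omega> =
     geo_comb (lam n) (random_KM T vs lam x0 n \<omega>) (T (vs n \<omega>) (random_KM T vs lam x0 n \<omega>))"

definition modulus_total_boundedness :: "'a::metric_space set \<Rightarrow> (nat \<Rightarrow> nat) \<Rightarrow> bool" where
  "modulus_total_boundedness A \<gamma> \<longleftrightarrow>
     (\<forall>k. \<forall>y::nat \<Rightarrow> 'a. (\<forall>n. y n \<in> A) \<longrightarrow>
        (\<exists>i j. i < j \<and> j \<le> \<gamma> k \<and> dist (y i) (y j) \<le> 1 / (real k + 1)))"

definition rate_of_divergence :: "(nat \<Rightarrow> real) \<Rightarrow> (nat \<Rightarrow> real \<Rightarrow> nat) \<Rightarrow> bool" where
  "rate_of_divergence a \<theta> \<longleftrightarrow> (\<forall>N b. b > 0 \<longrightarrow> (\<Sum>n=N..\<theta> N b. a n) \<ge> b)"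

text \<open>The event is required to be measurable, because \<^const>\<open>measure\<close> returns \<open>0\<close> on
  non-measurable sets.\<close>

definition rate_of_metastability ::
    "'o measure \<Rightarrow> (nat \<Rightarrow> 'o \<Rightarrow> 'a::metric_space) \<Rightarrow>
     (real \<Rightarrow> nat \<Rightarrow> (nat \<Rightarrow> nat) \<Rightarrow> nat) \<Rightarrow> bool" where
  "rate_of_metastability M x \<Delta> \<longleftrightarrow> (\<forall>\<epsilon>>0. \<forall>k g.
     (let E = {\<omega> \<in> space M. \<forall>n\<le>\<Delta> \<epsilon> k g. \<exists>i\<in>{n..n + g n}. \<exists>j\<in>{n..n + g n}.
                 dist (x i \<omega>) (x j \<omega>) > 1 / (real k + 1)}
      in E \<in> sets M \<and> measure M E < \<epsilon>))"

text \<open>The rate of metastability below comes from the following argument.  Put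
  \<open>\<delta> = 1/(8(k+1))\<close>, let \<open>K\<close> be the value of the modulus of total boundedness at precision \<open>\<delta>\<close>,
  and let \<open>\<phi>(y)\<close> be the expectation of \<open>d(y, T\<^sub>v y)\<^sup>2\<close>.

  The expectations of \<open>\<lambda>\<^sub>n(1 - \<lambda>\<^sub>n) \<phi>(x\<^sub>n)\<close> sum to at most \<open>c\<^sup>2\<close>, so for every \<open>\<mu> > 0\<close> some
  stage \<open>m \<le> \<theta>(0, c\<^sup>2/\<mu>)\<close> has \<open>E \<phi>(x\<^sub>m) \<le> \<mu>\<close>.  Such stages \<open>m\<^sub>0, \<dots>, m\<^sub>K\<close> are chosen
  successively: \<open>B\<close> at index \<open>j\<close> bounds \<open>m\<^sub>i\<close>, and \<open>R\<close> bounds \<open>m\<^sub>i + g(m\<^sub>i)\<close>, for all \<open>i < j\<close>.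

  The choice of \<open>\<mu>\<close> gives \<open>\<phi>(x(m\<^sub>j)) \<le> e\<^sup>2\<close> up to probability \<open>\<epsilon>/(4(K+1))\<close>.  A maximal
  \<open>\<delta>\<close>-separated subset of \<open>{y \<in> X\<^sub>0. \<phi>(y) \<le> e\<^sup>2}\<close> has at most \<open>K\<close> points \<open>y\<close>, and by the choice
  of \<open>e\<close> each of them has displacements by the first \<open>R\<close> sampled mappings of sum at most
  \<open>\<delta>\<close>, again up to total probability \<open>\<epsilon>/(4(K+1))\<close>.  Outside these exceptional events take
  \<open>i < j\<close> with \<open>x(m\<^sub>i)\<close>, \<open>x(m\<^sub>j)\<close> at distance at most \<open>\<delta>\<close> and such a \<open>y\<close> within \<open>\<delta>\<close> of
  \<open>x(m\<^sub>j)\<close>: on \<open>[m\<^sub>i; m\<^sub>i + g(m\<^sub>i)]\<close> the sequence stays within \<open>3\<delta>\<close> of \<open>y\<close>.\<close>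

primrec metastability_stage ::
    "real \<Rightarrow> nat \<Rightarrow> real \<Rightarrow> (nat \<Rightarrow> real \<Rightarrow> nat) \<Rightarrow> real \<Rightarrow> (nat \<Rightarrow> nat) \<Rightarrow> nat \<Rightarrow> nat" where
  "metastability_stage c K \<delta> \<theta> \<epsilon> g 0 = 0"
| "metastability_stage c K \<delta> \<theta> \<epsilon> g (Suc j) =
     (let B = metastability_stage c K \<delta> \<theta> \<epsilon> g j;
          R = B + Max (g ` {..B});
          e = \<epsilon> * \<delta> / (4 * (real K + 1)\<^sup>2 * (real R + 1));
          \<mu> = \<epsilon> * e\<^sup>2 / (4 * (real K + 1))
      in max B (\<theta> 0 (c\<^sup>2 / \<mu>)))"

definition explicit_metastability_rate ::
    "real \<Rightarrow> (nat \<Rightarrow> nat) \<Rightarrow> (nat \<Rightarrow> real \<Rightarrow> nat) \<Rightarrow> real \<Rightarrow> nat \<Rightarrow> (nat \<Rightarrow> nat) \<Rightarrow> nat" where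
  "explicit_metastability_rate c \<gamma> \<theta> \<epsilon> k g =
     (let K = \<gamma> (8 * k + 7); \<delta> = 1 / (8 * (real k + 1))
      in metastability_stage c K \<delta> \<theta> \<epsilon> g (Suc K))"

end

theory Submission
  imports Defs
begin

text \<open>
  Let \<open>\<phi>(y)\<close> be the expectation of \<open>d(y, T\<^sub>v y)\<^sup>2\<close>, called \<open>msd y\<close> below.  The random
  fixed points are the zeros of \<open>\<phi>\<close>, and \<open>\<phi>\<close> links the iteration to them in three ways.

  \<^item> Since \<open>x\<^sub>n\<close> depends only on \<open>v\<^sub>0, \<dots>, v\<^sub>n\<^sub>-\<^sub>1\<close>, it is independent of \<open>v\<^sub>n\<close>, so the expectation of
    the squared step displacement \<open>d(x\<^sub>n, T x\<^sub>n)\<^sup>2\<close>, with \<open>T\<close> the mapping of the sample \<open>v\<^sub>n\<close>, is that of \<open>\<phi>(x\<^sub>n)\<close>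
    (\<open>nn_integral_displacement_eq_msd\<close>).

  \<^item> The CAT(0) inequality at a common fixed point \<open>p\<close> bounds
    \<open>\<Sum> \<lambda>\<^sub>n (1 - \<lambda>\<^sub>n) d(x\<^sub>n, T x\<^sub>n)\<^sup>2\<close> by \<open>d(x\<^sub>0, p)\<^sup>2\<close>.  Hence the expectations of
    \<open>\<lambda>\<^sub>n (1 - \<lambda>\<^sub>n) \<phi>(x\<^sub>n)\<close> sum to at most \<open>c\<^sup>2\<close> (\<open>sum_nn_integral_msd_le\<close>), and since the
    \<open>\<lambda>\<^sub>n (1 - \<lambda>\<^sub>n)\<close> are not summable, \<open>\<phi>(x\<^sub>n)\<close> is small at some stages.

  \<^item> The distance to an arbitrary point \<open>y\<close> grows in each step by at most the displacement of \<open>y\<close>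
    under the sampled mapping (\<open>X_Suc_dist_le\<close>).  If \<open>\<phi>(y) = 0\<close>, the distance almost surely
    never grows; if \<open>\<phi>(y)\<close> is merely small, it is unlikely to grow much over a given number of
    steps.

  For the almost sure convergence, \<open>\<phi>(x\<^sub>n)\<close> tends to \<open>0\<close> along a subsequence, which by properness
  has a cluster point \<open>q\<close>, and \<open>\<phi>(q) = 0\<close> by continuity.  The distances to \<open>q\<close> would then
  decrease, except that \<open>q\<close> is random and the almost sure monotonicity is known only for one fixed
  point at a time.  The points of a countable dense set of fixed points take its place
  (\<open>converges_to_random_fixed_point\<close>).

  The rate of metastability is the finitary form of the same argument.  Again \<open>x\<^sub>m\<close> is random at a
  stage \<open>m\<close> with \<open>\<phi>(x\<^sub>m)\<close> small, so the drift estimate does not apply to it directly; it is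
  replaced by one of finitely many deterministic points from a \<open>\<delta>\<close>-separated set
  (\<open>anchor_off_small_event\<close>).  An anchor controls only the samples up to a horizon chosen
  before the stage \<open>m\<close> itself is known, so it cannot cover the steps after \<open>m\<close>.  With more stages
  than the \<open>\<delta>\<close>-capacity of the ball, however, some later stage returns close to an
  earlier one, and the anchor of the later stage keeps the sequence together on the interval
  \<open>[n; n + g(n)]\<close> that starts at the earlier stage \<open>n\<close> (\<open>metastability\<close>).
\<close>

section \<open>Convex combinations in Hadamard spaces\<close>

lemma is_geodesic_dist:
  assumes "is_geodesic x y \<sigma>" "0 \<le> l" "l \<le> 1"
  shows "dist x (\<sigma> (l * dist x y)) = l * dist x y"
    and "dist y (\<sigma> (l * dist x y)) = (1 - l) * dist x y"
proof -
  have t: "l * dist x y \<in> {0..dist x y}"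
    using assms(2,3) by (auto simp: mult_left_le_one_le)
  have *: "\<sigma> 0 = x" "\<sigma> (dist x y) = y"
      "\<And>s t. s \<in> {0..dist x y} \<Longrightarrow> t \<in> {0..dist x y} \<Longrightarrow> dist (\<sigma> s) (\<sigma> t) = \<bar>s - t\<bar>"
    using assms(1) unfolding is_geodesic_def by auto
  show "dist x (\<sigma> (l * dist x y)) = l * dist x y"
    using *(3)[of 0 "l * dist x y"] t *(1) by auto
  show "dist y (\<sigma> (l * dist x y)) = (1 - l) * dist x y"
    using *(3)[of "dist x y" "l * dist x y"] t *(2) by (auto simp: algebra_simps)
qed

lemma geo_comb_eq_geodesic:
  fixes x y :: "'a::hadamard_space"
  assumes \<sigma>: "is_geodesic x y \<sigma>" and l: "0 \<le> l" "l \<le> 1"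
  shows "geo_comb l x y = \<sigma> (l * dist x y)"
  unfolding geo_comb_def
proof (rule the_equality)
  have t: "l * dist x y \<in> {0..dist x y}"
    using l by (auto simp: mult_left_le_one_le)
  show "(\<exists>\<sigma>'. is_geodesic x y \<sigma>' \<and> \<sigma> (l * dist x y) \<in> \<sigma>' ` {0..dist x y}) \<and>
      dist x (\<sigma> (l * dist x y)) = l * dist x y \<and>
      dist y (\<sigma> (l * dist x y)) = (1 - l) * dist x y"
    using \<sigma> t is_geodesic_dist[OF \<sigma> l] by blast
next
  fix w
  assume w: "(\<exists>\<sigma>'. is_geodesic x y \<sigma>' \<and> w \<in> \<sigma>' ` {0..dist x y}) \<and>
      dist x w = l * dist x y \<and> dist y w = (1 - l) * dist x y"
  then obtain \<tau> t where \<tau>: "is_geodesic x y \<tau>" "t \<in> {0..dist x y}" "w = \<tau> t" by blast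
  have "dist x w = t"
    using \<tau> unfolding is_geodesic_def by force
  then show "w = \<sigma> (l * dist x y)"
    using geodesic_unique[OF \<tau>(1) \<sigma> \<tau>(2)] w \<tau>(3) by simp
qed

lemma dist_geo_comb:
  fixes x y :: "'a::hadamard_space"
  assumes "0 \<le> l" "l \<le> 1"
  shows "dist x (geo_comb l x y) = l * dist x y"
    and "dist y (geo_comb l x y) = (1 - l) * dist x y"
proof -
  obtain \<sigma> where "is_geodesic x y \<sigma>" using geodesic_exists by blast
  then show "dist x (geo_comb l x y) = l * dist x y" "dist y (geo_comb l x y) = (1 - l) * dist x y"
    using is_geodesic_dist[of x y \<sigma> l] geo_comb_eq_geodesic[of x y \<sigma> l] assms by simp_all
qed

text \<open>Convex combinations are jointly continuous.  The distances of the moving combination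
  \<open>w\<close> of \<open>f i\<close> and \<open>g i\<close> from \<open>x\<close> and \<open>y\<close> are in the limit at most \<open>l d(x,y)\<close> and \<open>(1 - l) d(x,y)\<close>;
  for such \<open>w\<close> the CAT(0) inequality, applied to \<open>x\<close>, \<open>y\<close> and \<open>w\<close>, leaves only \<open>0\<close> as a bound for the
  distance of \<open>w\<close> from \<open>(1 - l) x \<oplus> l y\<close>.  The measurability of the iterates rests on this.\<close>

lemma tendsto_geo_comb:
  fixes x y :: "'a::hadamard_space"
  assumes l: "0 \<le> l" "l \<le> 1" and f: "(f \<longlongrightarrow> x) F" and g: "(g \<longlongrightarrow> y) F"
  shows "((\<lambda>i. geo_comb l (f i) (g i)) \<longlongrightarrow> geo_comb l x y) F"
proof -
  define b where "b i = (1 - l) * (dist x (f i) + l * dist (f i) (g i))\<^sup>2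
      + l * (dist y (g i) + (1 - l) * dist (f i) (g i))\<^sup>2 - l * (1 - l) * (dist x y)\<^sup>2" for i
  have le: "(dist (geo_comb l (f i) (g i)) (geo_comb l x y))\<^sup>2 \<le> b i" for i
  proof -
    let ?w = "geo_comb l (f i) (g i)"
    have "dist x ?w \<le> dist x (f i) + l * dist (f i) (g i)"
      using dist_triangle[of x ?w "f i"] dist_geo_comb(1)[OF l, of "f i" "g i"] by simp
    moreover have "dist y ?w \<le> dist y (g i) + (1 - l) * dist (f i) (g i)"
      using dist_triangle[of y ?w "g i"] dist_geo_comb(2)[OF l, where y="g i" and x="f i"] by simp
    ultimately have "(1 - l) * (dist x ?w)\<^sup>2 + l * (dist y ?w)\<^sup>2 - l * (1 - l) * (dist x y)\<^sup>2 \<le> b i"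
      unfolding b_def using l by (intro diff_mono add_mono mult_left_mono power_mono) auto
    then show ?thesis
      using CAT0_inequality[OF l, of x y ?w] by (simp add: dist_commute)
  qed
  have "(b \<longlongrightarrow> (1 - l) * (dist x x + l * dist x y)\<^sup>2
      + l * (dist y y + (1 - l) * dist x y)\<^sup>2 - l * (1 - l) * (dist x y)\<^sup>2) F"
    unfolding b_def by (intro tendsto_intros f g)
  also have "(1 - l) * (dist x x + l * dist x y)\<^sup>2
      + l * (dist y y + (1 - l) * dist x y)\<^sup>2 - l * (1 - l) * (dist x y)\<^sup>2 = 0"
    by (simp add: power2_eq_square algebra_simps)
  finally have "(b \<longlongrightarrow> 0) F" .
  then have "((\<lambda>i. (dist (geo_comb l (f i) (g i)) (geo_comb l x y))\<^sup>2) \<longlongrightarrow> 0) F"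
    by (rule tendsto_sandwich[OF _ _ tendsto_const, rotated 2]) (auto simp: le)
  then have "((\<lambda>i. sqrt ((dist (geo_comb l (f i) (g i)) (geo_comb l x y))\<^sup>2)) \<longlongrightarrow> sqrt 0) F"
    by (rule tendsto_real_sqrt)
  then show ?thesis
    by (subst tendsto_dist_iff) simp
qed

text \<open>Second countability makes the Borel sets of \<open>X \<times> X\<close> the product of the Borel sets of \<open>X\<close>, so
  that distances between random points are random variables.  A countable base comes from finite
  covers of the balls \<open>cball p n\<close> by balls of radius \<open>1/(m+1)\<close>.\<close>

instance proper_hadamard_space \<subseteq> second_countable_topology
proof
  obtain p :: 'a where True by blast
  define P where "P n m S \<longleftrightarrow> finite S \<and> cball p (real n) \<subseteq> (\<Union>x\<in>S. ball x (1 / real (Suc m)))"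
    for n m :: nat and S
  have "\<exists>S. P n m S" for n m
  proof -
    have "x \<in> ball x (1 / real (Suc m))" for x :: 'a by simp
    then have "cball p (real n) \<subseteq> (\<Union>x\<in>UNIV. ball x (1 / real (Suc m)))" by blast
    then show ?thesis
      unfolding P_def
      by (rule compactE_image[OF compact_cball_proper[of p "real n"] open_ball]) blast
  qed
  then obtain S where S: "\<And>n m. P n m (S n m)" by metis
  define B where "B = (\<Union>n m. (\<lambda>x. ball x (1 / real (Suc m))) ` S n m)"
  have "countable B"
    unfolding B_def using S by (intro countable_UN countable_image) (auto simp: P_def countable_finite)
  moreover have "topological_basis B"
  proof (rule topological_basisI)
    show "open U" if "U \<in> B" for U using that unfolding B_def by auto
    fix U :: "'a set" and x assume "open U" "x \<in> U"
    then obtain e where e: "0 < e" "ball x e \<subseteq> U" by (meson openE)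
    obtain m where m: "1 / real (Suc m) < e / 2"
      using e by (metis half_gt_zero inverse_eq_divide reals_Archimedean)
    obtain n where n: "dist p x \<le> real n" by (meson real_arch_simple)
    then obtain y where y: "y \<in> S n m" "x \<in> ball y (1 / real (Suc m))"
      using S[of n m] unfolding P_def by auto
    have "ball y (1 / real (Suc m)) \<subseteq> ball x e"
    proof
      fix z assume "z \<in> ball y (1 / real (Suc m))"
      with y(2) m dist_triangle[of x z y] show "z \<in> ball x e"
        by (auto simp: dist_commute)
    qed
    then show "\<exists>U'\<in>B. x \<in> U' \<and> U' \<subseteq> U"
      using y e unfolding B_def by blast
  qed
  ultimately show "\<exists>B::'a set set. countable B \<and> open = generate_topology B"
    using topological_basis_imp_subbasis by auto
qed


text \<open>Both \<open>x\<close> and \<open>Tx\<close> lie in the ball about \<open>y\<close> of radius \<open>d(x,y) + d(y,Ty)\<close>, and balls are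
  convex in a CAT(0) space.\<close>

lemma step_dist_le:
  fixes x y :: "'a::hadamard_space"
  assumes l: "0 \<le> l" "l \<le> 1" and ne: "dist Tx Ty \<le> dist x y"
  shows "dist (geo_comb l x Tx) y \<le> dist x y + dist y Ty"
proof (rule power2_le_imp_le)
  have "dist Tx y \<le> dist x y + dist y Ty"
    using dist_triangle[of Tx y Ty] ne by (simp add: dist_commute)
  then have "(dist Tx y)\<^sup>2 \<le> (dist x y + dist y Ty)\<^sup>2"
    by (intro power_mono) auto
  moreover have "(dist x y)\<^sup>2 \<le> (dist x y + dist y Ty)\<^sup>2"
    by (intro power_mono) auto
  ultimately have "(1 - l) * (dist x y)\<^sup>2 + l * (dist Tx y)\<^sup>2
      \<le> (1 - l) * (dist x y + dist y Ty)\<^sup>2 + l * (dist x y + dist y Ty)\<^sup>2"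
    using l by (intro add_mono mult_left_mono) auto
  also have "\<dots> = (dist x y + dist y Ty)\<^sup>2" by (simp add: algebra_simps)
  finally have "(1 - l) * (dist x y)\<^sup>2 + l * (dist Tx y)\<^sup>2 \<le> (dist x y + dist y Ty)\<^sup>2" .
  moreover have "0 \<le> l * (1 - l) * (dist x Tx)\<^sup>2" using l by simp
  ultimately show "(dist (geo_comb l x Tx) y)\<^sup>2 \<le> (dist x y + dist y Ty)\<^sup>2"
    using CAT0_inequality[OF l, of x Tx y] by linarith
qed auto

text \<open>When \<open>p\<close> is fixed, the negative term of the CAT(0) inequality is kept: the squared distance
  to \<open>p\<close> pays for the squared displacement of the step.\<close>

lemma step_dist_fixed_point:
  fixes x p :: "'a::hadamard_space"
  assumes l: "0 \<le> l" "l \<le> 1" and ne: "dist Tx p \<le> dist x p"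
  shows "l * (1 - l) * (dist x Tx)\<^sup>2 + (dist (geo_comb l x Tx) p)\<^sup>2 \<le> (dist x p)\<^sup>2"
proof -
  have "l * (dist Tx p)\<^sup>2 \<le> l * (dist x p)\<^sup>2"
    using ne l by (intro mult_left_mono power_mono) auto
  then show ?thesis
    using CAT0_inequality[OF l, of x Tx p] by (simp add: algebra_simps)
qed

section \<open>Separated sets and a tail estimate\<close>

lemma modulus_total_boundedness_card_separated:
  assumes \<gamma>: "modulus_total_boundedness A \<gamma>" and S: "finite S" "S \<subseteq> A"
    and sep: "\<And>x y. x \<in> S \<Longrightarrow> y \<in> S \<Longrightarrow> x \<noteq> y \<Longrightarrow> 1 / (real k + 1) < dist x y"
  shows "card S \<le> \<gamma> k"
proof (rule ccontr)
  assume "\<not> card S \<le> \<gamma> k"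
  then have K: "\<gamma> k < card S" by simp
  obtain h where h: "bij_betw h {..<card S} S"
    using S(1) ex_bij_betw_nat_finite[of S] by (auto simp: atLeast0LessThan)
  \<comment> \<open>The modulus speaks of infinite sequences but only looks at indices up to \<open>\<gamma> k < card S\<close>.\<close>
  define y where "y n = h (if n < card S then n else 0)" for n
  have "\<forall>n. y n \<in> A"
    using h S(2) K unfolding y_def bij_betw_def by auto
  then obtain i j where ij: "i < j" "j \<le> \<gamma> k" "dist (y i) (y j) \<le> 1 / (real k + 1)"
    using \<gamma> unfolding modulus_total_boundedness_def by blast
  with K have lt: "i < card S" "j < card S" by auto
  then have "h i \<noteq> h j" "h i \<in> S" "h j \<in> S"
    using h ij(1) unfolding bij_betw_def by (auto dest: inj_onD)
  with sep[of "h i" "h j"] ij(3) lt show False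
    unfolding y_def by auto
qed

text \<open>A point of \<open>W\<close> farther than \<open>\<delta>\<close> from a separated set of largest cardinality could be added
  to it.\<close>

lemma maximal_separated_subset:
  fixes W :: "'a::metric_space set"
  assumes \<delta>: "0 \<le> \<delta>"
    and bound: "\<And>S. finite S \<Longrightarrow> S \<subseteq> W \<Longrightarrow>
      (\<And>x y. x \<in> S \<Longrightarrow> y \<in> S \<Longrightarrow> x \<noteq> y \<Longrightarrow> \<delta> < dist x y) \<Longrightarrow> card S \<le> K"
  obtains S where "finite S" "S \<subseteq> W" "card S \<le> K" "\<And>w. w \<in> W \<Longrightarrow> \<exists>y\<in>S. dist w y \<le> \<delta>"
proof -
  define P where "P S \<longleftrightarrow> finite S \<and> S \<subseteq> W \<and> (\<forall>x\<in>S. \<forall>y\<in>S. x \<noteq> y \<longrightarrow> \<delta> < dist x y)" for S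
  have P_card: "card S \<le> K" if "P S" for S
    using that bound[of S] unfolding P_def by blast
  have "P {}" unfolding P_def by simp
  then obtain S where S: "P S" and max: "\<And>S'. P S' \<Longrightarrow> card S' \<le> card S"
    using ex_has_greatest_nat[of P "{}" card "Suc K"] P_card by (auto simp: less_Suc_eq_le)
  have "\<exists>y\<in>S. dist w y \<le> \<delta>" if w: "w \<in> W" for w
  proof (rule ccontr)
    assume "\<not> ?thesis"
    then have far: "\<And>y. y \<in> S \<Longrightarrow> \<delta> < dist w y" by force
    then have "w \<notin> S" using \<delta> by force
    moreover have "P (insert w S)"
      using S w far unfolding P_def by (auto simp: dist_commute)
    ultimately show False
      using max[of "insert w S"] S unfolding P_def by simp
  qed
  then show ?thesis
    using that[of S] S P_card[of S] unfolding P_def by blast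
qed

text \<open>The iterate \<open>x\<^sub>n\<close> is a function of the first \<open>n\<close> samples, hence independent of the sample used in
  the next step.\<close>

lemma random_KM_cong:
  "(\<And>i. i < n \<Longrightarrow> vs i \<omega> = ws i \<omega>') \<Longrightarrow>
    random_KM T vs lam x0 n \<omega> = random_KM T ws lam x0 n \<omega>'"
  by (induction n) auto

text \<open>Markov's inequality, in the shape needed to split off exceptional events of prescribed
  probability.\<close>

lemma (in prob_space) prob_greater_le_of_nn_integral_le:
  assumes f: "f \<in> borel_measurable M" and t: "0 < t" and b: "0 \<le> b"
    and le: "(\<integral>\<^sup>+\<omega>. f \<omega> \<partial>M) \<le> ennreal (b * t)"
  shows "prob {\<omega> \<in> space M. ennreal t < f \<omega>} \<le> b"
proof -
  have "{\<omega> \<in> space M. ennreal t < f \<omega>} \<subseteq> {\<omega> \<in> space M. 1 \<le> ennreal (1 / t) * f \<omega>}"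
  proof safe
    fix \<omega> assume "ennreal t < f \<omega>"
    then have "ennreal (1 / t) * ennreal t \<le> ennreal (1 / t) * f \<omega>"
      by (intro mult_left_mono) auto
    then show "1 \<le> ennreal (1 / t) * f \<omega>"
      using t by (simp add: ennreal_mult[symmetric])
  qed
  then have "emeasure M {\<omega> \<in> space M. ennreal t < f \<omega>}
      \<le> emeasure M {\<omega> \<in> space M. 1 \<le> ennreal (1 / t) * f \<omega>}"
    using f by (intro emeasure_mono) auto
  also have "\<dots> \<le> ennreal (1 / t) * (\<integral>\<^sup>+\<omega>. f \<omega> * indicator (space M) \<omega> \<partial>M)"
    using f by (intro nn_integral_Markov_inequality) auto
  also have "(\<integral>\<^sup>+\<omega>. f \<omega> * indicator (space M) \<omega> \<partial>M) = (\<integral>\<^sup>+\<omega>. f \<omega> \<partial>M)"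
    by (intro nn_integral_cong) auto
  also have "ennreal (1 / t) * (\<integral>\<^sup>+\<omega>. f \<omega> \<partial>M) \<le> ennreal (1 / t) * ennreal (b * t)"
    using le by (intro mult_left_mono) auto
  also have "\<dots> = ennreal b"
    using t b by (simp add: ennreal_mult[symmetric])
  finally show ?thesis
    using b by (simp add: emeasure_eq_measure)
qed

section \<open>The random iteration and the mean squared displacement\<close>

locale random_KM_iteration = prob_space M for M :: "'o measure" +
  fixes V :: "'v measure"
    and T :: "'v \<Rightarrow> 'a::proper_hadamard_space \<Rightarrow> 'a"
    and v :: "'o \<Rightarrow> 'v" and vs :: "nat \<Rightarrow> 'o \<Rightarrow> 'v"
    and lam :: "nat \<Rightarrow> real" and x0 p :: 'a and c :: real
  assumes nonexpansive: "\<And>u y z. u \<in> space V \<Longrightarrow> dist (T u y) (T u z) \<le> dist y z"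
    and T_measurable: "(\<lambda>(u, y). T u y) \<in> V \<Otimes>\<^sub>M borel \<rightarrow>\<^sub>M borel"
    and v_measurable[measurable]: "v \<in> M \<rightarrow>\<^sub>M V"
    and p_fixed: "p \<in> random_fixed_points M T v"
    and x0_near: "dist x0 p \<le> c"
    and lam_range: "\<And>n. lam n \<in> {0<..1}"
    and vs_measurable[measurable]: "\<And>n. vs n \<in> M \<rightarrow>\<^sub>M V"
    and vs_indep: "indep_vars (\<lambda>_. V) vs UNIV"
    and vs_distr: "\<And>n. distr M V (vs n) = distr M V v"
begin

abbreviation X :: "nat \<Rightarrow> 'o \<Rightarrow> 'a" where "X \<equiv> random_KM T vs lam x0"

definition law :: "'v measure" where "law = distr M V v"

text \<open>The mean squared displacement of a deterministic point.  Values in \<open>ennreal\<close> make the function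
  defined and measurable without integrability conditions.\<close>

definition msd :: "'a \<Rightarrow> ennreal" where
  "msd y = (\<integral>\<^sup>+u. ennreal ((dist y (T u y))\<^sup>2) \<partial>law)"

lemma sets_law[measurable_cong, simp]: "sets law = sets V"
  by (simp add: law_def)

lemma space_law[simp]: "space law = space V"
  by (simp add: law_def)

lemma prob_space_law: "prob_space law"
  unfolding law_def by (rule prob_space_distr) measurable

lemma measurable_T[measurable (raw)]:
  assumes "f \<in> N \<rightarrow>\<^sub>M V" "h \<in> borel_measurable N"
  shows "(\<lambda>\<omega>. T (f \<omega>) (h \<omega>)) \<in> borel_measurable N"
  using measurable_compose[OF measurable_Pair[OF assms] T_measurable] by simp

lemma lam_01: "0 \<le> lam n" "lam n \<le> 1" "0 \<le> lam n * (1 - lam n)"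
  using lam_range[of n] by auto

lemma measurable_random_KM:
  assumes "\<And>i. i < n \<Longrightarrow> ws i \<in> N \<rightarrow>\<^sub>M V"
  shows "random_KM T ws lam x0 n \<in> borel_measurable N"
  using assms
proof (induction n)
  case 0
  have "random_KM T ws lam x0 0 = (\<lambda>_. x0)" by auto
  then show ?case by simp
next
  case (Suc n)
  have [measurable]: "random_KM T ws lam x0 n \<in> borel_measurable N" "ws n \<in> N \<rightarrow>\<^sub>M V"
    using Suc by auto
  have "continuous_on UNIV (\<lambda>z. geo_comb (lam n) (fst z) (snd z :: 'a))"
    unfolding continuous_on_def by (intro ballI tendsto_geo_comb lam_01 tendsto_intros)
  from borel_measurable_continuous_Pair[OF _ _ this, of "random_KM T ws lam x0 n" N
      "\<lambda>\<omega>. T (ws n \<omega>) (random_KM T ws lam x0 n \<omega>)"]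
  have "(\<lambda>\<omega>. geo_comb (lam n) (random_KM T ws lam x0 n \<omega>)
      (T (ws n \<omega>) (random_KM T ws lam x0 n \<omega>))) \<in> borel_measurable N"
    by measurable
  moreover have "random_KM T ws lam x0 (Suc n) = (\<lambda>\<omega>. geo_comb (lam n) (random_KM T ws lam x0 n \<omega>)
      (T (ws n \<omega>) (random_KM T ws lam x0 n \<omega>)))" by auto
  ultimately show ?case by simp
qed

lemma measurable_X[measurable]: "X n \<in> borel_measurable M"
  by (rule measurable_random_KM) measurable

lemma measurable_msd[measurable]: "msd \<in> borel_measurable borel"
proof -
  interpret law: prob_space law by (rule prob_space_law)
  show ?thesis unfolding msd_def by measurable
qed

lemma nn_integral_vs:
  assumes [measurable]: "h \<in> borel_measurable V"
  shows "(\<integral>\<^sup>+\<omega>. h (vs n \<omega>) \<partial>M) = (\<integral>\<^sup>+u. h u \<partial>law)"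
  unfolding law_def by (subst vs_distr[of n, symmetric], subst nn_integral_distr) simp_all

lemma AE_vs_fixed:
  assumes "z \<in> random_fixed_points M T v"
  shows "AE \<omega> in M. \<forall>n. T (vs n \<omega>) z = z"
proof (subst AE_all_countable, rule allI)
  fix n
  have [measurable]: "{u \<in> space V. T u z = z} \<in> sets V" by measurable
  have "AE u in law. T u z = z"
    unfolding law_def using assms
    by (subst AE_distr_iff) (auto simp: random_fixed_points_def)
  then have "AE u in distr M V (vs n). T u z = z"
    unfolding law_def vs_distr .
  then show "AE \<omega> in M. T (vs n \<omega>) z = z"
    by (subst (asm) AE_distr_iff) auto
qed

lemma random_fixed_point_iff_msd: "z \<in> random_fixed_points M T v \<longleftrightarrow> msd z = 0"
proof -
  have [measurable]: "{u \<in> space V. T u z = z} \<in> sets V" by measurable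
  have "msd z = 0 \<longleftrightarrow> (AE u in law. ennreal ((dist z (T u z))\<^sup>2) = 0)"
    unfolding msd_def by (rule nn_integral_0_iff_AE) measurable
  also have "\<dots> \<longleftrightarrow> (AE u in law. T u z = z)"
    by (simp add: eq_commute[of z])
  also have "\<dots> \<longleftrightarrow> (AE \<omega> in M. T (v \<omega>) z = z)"
    unfolding law_def by (rule AE_distr_iff) auto
  finally show ?thesis by (simp add: random_fixed_points_def)
qed

text \<open>The displacement \<open>y \<mapsto> d(y, T\<^sub>u y)\<close> of a nonexpansive map is \<open>2\<close>-Lipschitz, and
  \<open>(s + 2t)\<^sup>2 \<le> 2s\<^sup>2 + 8t\<^sup>2\<close>.  This form of continuity of \<open>msd\<close> suffices to see that it vanishes at a limit
  of points along which it tends to \<open>0\<close>.\<close>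

lemma msd_le_of_close: "msd z \<le> 2 * msd y + ennreal (8 * (dist y z)\<^sup>2)"
proof -
  interpret law: prob_space law by (rule prob_space_law)
  have "ennreal ((dist z (T u z))\<^sup>2) \<le> 2 * ennreal ((dist y (T u y))\<^sup>2) + ennreal (8 * (dist y z)\<^sup>2)"
    if "u \<in> space V" for u
  proof -
    have "dist z (T u z) \<le> dist y (T u y) + 2 * dist y z"
      using nonexpansive[OF that, of y z] dist_triangle[of z "T u z" y]
        dist_triangle[of y "T u z" "T u y"] by (simp add: dist_commute)
    then have "(dist z (T u z))\<^sup>2 \<le> (dist y (T u y) + 2 * dist y z)\<^sup>2"
      by (intro power_mono) auto
    also have "\<dots> \<le> 2 * (dist y (T u y))\<^sup>2 + 8 * (dist y z)\<^sup>2"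
      using sum_squares_bound[of "dist y (T u y)" "2 * dist y z"]
      by (simp add: power2_eq_square algebra_simps)
    finally have "ennreal ((dist z (T u z))\<^sup>2)
        \<le> ennreal (2 * (dist y (T u y))\<^sup>2 + 8 * (dist y z)\<^sup>2)"
      by (rule ennreal_leI)
    also have "\<dots> = 2 * ennreal ((dist y (T u y))\<^sup>2) + ennreal (8 * (dist y z)\<^sup>2)"
      by (simp add: ennreal_mult)
    finally show ?thesis .
  qed
  then have "msd z \<le> (\<integral>\<^sup>+u. 2 * ennreal ((dist y (T u y))\<^sup>2) + ennreal (8 * (dist y z)\<^sup>2) \<partial>law)"
    unfolding msd_def by (intro nn_integral_mono) auto
  also have "\<dots> = 2 * msd y + ennreal (8 * (dist y z)\<^sup>2)"
    unfolding msd_def by (simp add: nn_integral_add nn_integral_cmult law.emeasure_space_1[simplified])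
  finally show ?thesis .
qed

text \<open>The first moment is bounded by the root of the second: integrate \<open>d \<le> d\<^sup>2/(2e) + e/2\<close>, the
  inequality of arithmetic and geometric means.\<close>

lemma mean_displacement_le:
  assumes e: "0 < e" and le: "msd y \<le> ennreal (e\<^sup>2)"
  shows "(\<integral>\<^sup>+u. ennreal (dist y (T u y)) \<partial>law) \<le> ennreal e"
proof -
  interpret law: prob_space law by (rule prob_space_law)
  have "ennreal (dist y (T u y)) \<le> ennreal (1 / (2 * e)) * ennreal ((dist y (T u y))\<^sup>2) + ennreal (e / 2)" for u
  proof -
    have "dist y (T u y) \<le> 1 / (2 * e) * (dist y (T u y))\<^sup>2 + e / 2"
      using e sum_squares_bound[of "dist y (T u y)" e] by (simp add: field_simps power2_eq_square)
    then have "ennreal (dist y (T u y)) \<le> ennreal (1 / (2 * e) * (dist y (T u y))\<^sup>2 + e / 2)"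
      by (rule ennreal_leI)
    then show ?thesis using e by (simp add: ennreal_mult[symmetric] ennreal_plus[symmetric] del: ennreal_plus)
  qed
  then have "(\<integral>\<^sup>+u. ennreal (dist y (T u y)) \<partial>law)
      \<le> (\<integral>\<^sup>+u. ennreal (1 / (2 * e)) * ennreal ((dist y (T u y))\<^sup>2) + ennreal (e / 2) \<partial>law)"
    by (intro nn_integral_mono)
  also have "\<dots> = ennreal (1 / (2 * e)) * msd y + ennreal (e / 2)"
    unfolding msd_def by (simp add: nn_integral_add nn_integral_cmult law.emeasure_space_1[simplified])
  also have "\<dots> \<le> ennreal (1 / (2 * e)) * ennreal (e\<^sup>2) + ennreal (e / 2)"
    using le by (intro add_mono mult_left_mono) auto
  also have "\<dots> = ennreal e"
    using e by (simp add: ennreal_mult[symmetric] ennreal_plus[symmetric] power2_eq_square del: ennreal_plus)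
  finally show ?thesis .
qed

text \<open>The step displacement at time \<open>n\<close> combines the random point \<open>x\<^sub>n\<close> with the fresh sample \<open>v\<^sub>n\<close>.  By
  independence the sample may be integrated out first with \<open>x\<^sub>n\<close> held fixed.  The two are values of
  different types, whereas \<^const>\<open>indep_var\<close> relates variables of equal type; the product formula is
  therefore applied to the tuples of past samples and of the present one, with \<open>x\<^sub>n\<close> written as a
  function \<open>?F\<close> of the past.\<close>

lemma nn_integral_displacement_eq_msd:
  "(\<integral>\<^sup>+\<omega>. ennreal ((dist (X n \<omega>) (T (vs n \<omega>) (X n \<omega>)))\<^sup>2) \<partial>M) = (\<integral>\<^sup>+\<omega>. msd (X n \<omega>) \<partial>M)"
proof -
  let ?F = "random_KM T (\<lambda>i w. w i) lam x0 n"
  let ?P = "PiM {..<n} (\<lambda>_. V)" and ?Q = "PiM {n} (\<lambda>_. V)"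
  let ?past = "\<lambda>\<omega>. restrict (\<lambda>i. vs i \<omega>) {..<n}"
  let ?now = "\<lambda>\<omega>. restrict (\<lambda>i. vs i \<omega>) {n}"
  let ?f = "\<lambda>w w'. ennreal ((dist (?F w) (T (w' n) (?F w)))\<^sup>2)"
  have F[measurable]: "?F \<in> borel_measurable ?P"
    by (rule measurable_random_KM) (auto intro: measurable_component_singleton)
  have comp[measurable]: "(\<lambda>w. w n) \<in> ?Q \<rightarrow>\<^sub>M V"
    by (rule measurable_component_singleton) auto
  have f[measurable]: "case_prod ?f \<in> borel_measurable (?P \<Otimes>\<^sub>M ?Q)" by measurable
  have [measurable]: "?past \<in> M \<rightarrow>\<^sub>M ?P" "?now \<in> M \<rightarrow>\<^sub>M ?Q" by measurable
  have "indep_var ?P ?past ?Q ?now"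
    by (rule indep_var_restrict[OF vs_indep]) auto
  then have prod: "distr M (?P \<Otimes>\<^sub>M ?Q) (\<lambda>\<omega>. (?past \<omega>, ?now \<omega>)) = distr M ?P ?past \<Otimes>\<^sub>M distr M ?Q ?now"
    by (simp add: indep_var_distribution_eq)
  interpret now: prob_space "distr M ?Q ?now" by (rule prob_space_distr) measurable
  have F_past: "?F (?past \<omega>) = X n \<omega>" for \<omega>
    by (rule random_KM_cong) auto
  have "(\<integral>\<^sup>+\<omega>. ennreal ((dist (X n \<omega>) (T (vs n \<omega>) (X n \<omega>)))\<^sup>2) \<partial>M)
      = (\<integral>\<^sup>+\<omega>. case_prod ?f (?past \<omega>, ?now \<omega>) \<partial>M)"
    by (simp add: F_past)
  also have "\<dots> = (\<integral>\<^sup>+z. case_prod ?f z \<partial>distr M (?P \<Otimes>\<^sub>M ?Q) (\<lambda>\<omega>. (?past \<omega>, ?now \<omega>)))"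
    by (rule nn_integral_distr[symmetric]) measurable
  also have "\<dots> = (\<integral>\<^sup>+w. \<integral>\<^sup>+w'. ?f w w' \<partial>distr M ?Q ?now \<partial>distr M ?P ?past)"
    unfolding prod by (subst now.nn_integral_fst[symmetric]) (use f in simp_all)
  also have "\<dots> = (\<integral>\<^sup>+w. msd (?F w) \<partial>distr M ?P ?past)"
  proof (rule nn_integral_cong)
    fix w assume "w \<in> space (distr M ?P ?past)"
    then have w: "w \<in> space ?P" by simp
    have "(\<integral>\<^sup>+w'. ?f w w' \<partial>distr M ?Q ?now) = (\<integral>\<^sup>+\<omega>. ennreal ((dist (?F w) (T (vs n \<omega>) (?F w)))\<^sup>2) \<partial>M)"
      by (subst nn_integral_distr) auto
    also have "\<dots> = msd (?F w)"
      unfolding msd_def by (rule nn_integral_vs) measurable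
    finally show "(\<integral>\<^sup>+w'. ?f w w' \<partial>distr M ?Q ?now) = msd (?F w)" .
  qed
  also have "\<dots> = (\<integral>\<^sup>+\<omega>. msd (X n \<omega>) \<partial>M)"
    by (subst nn_integral_distr) (auto simp: F_past)
  finally show ?thesis .
qed

lemma X_Suc_dist_le:
  assumes "\<omega> \<in> space M"
  shows "dist (X (Suc n) \<omega>) y \<le> dist (X n \<omega>) y + dist y (T (vs n \<omega>) y)"
  using step_dist_le[OF lam_01(1,2) nonexpansive[OF measurable_space[OF vs_measurable assms]]]
  by simp

text \<open>Summing the drift over all samples from the beginning, not only those from \<open>m\<close> on, keeps the
  drift term the same for all stages \<open>m\<close>, so that one exceptional event serves all of them.\<close>

lemma X_dist_le_drift:
  assumes \<omega>: "\<omega> \<in> space M"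
  shows "dist (X (m + n) \<omega>) y \<le> dist (X m \<omega>) y + (\<Sum>l<m + n. dist y (T (vs l \<omega>) y))"
proof (induction n)
  case 0
  show ?case by (simp add: sum_nonneg)
next
  case (Suc n)
  with X_Suc_dist_le[OF \<omega>, of "m + n" y] show ?case by simp
qed

lemma X_fejer:
  assumes \<omega>: "\<omega> \<in> space M" and z: "\<And>n. T (vs n \<omega>) z = z" and "m \<le> n"
  shows "dist (X n \<omega>) z \<le> dist (X m \<omega>) z"
  by (rule lift_Suc_antimono_le[OF _ \<open>m \<le> n\<close>]) (use X_Suc_dist_le[OF \<omega>, of _ z] z in simp)

lemma sum_displacement_le:
  assumes \<omega>: "\<omega> \<in> space M" and p: "\<And>n. T (vs n \<omega>) p = p"
  shows "(\<Sum>n<N. lam n * (1 - lam n) * (dist (X n \<omega>) (T (vs n \<omega>) (X n \<omega>)))\<^sup>2) + (dist (X N \<omega>) p)\<^sup>2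
    \<le> (dist x0 p)\<^sup>2"
proof (induction N)
  case (Suc N)
  have "dist (T (vs N \<omega>) (X N \<omega>)) p \<le> dist (X N \<omega>) p"
    using nonexpansive[OF measurable_space[OF vs_measurable \<omega>], of N "X N \<omega>" p] p by simp
  from step_dist_fixed_point[OF lam_01(1,2) this, of N] Suc show ?case by simp
qed simp

lemma AE_X_in_cball: "AE \<omega> in M. \<forall>n. X n \<omega> \<in> cball p c"
  using AE_vs_fixed[OF p_fixed] AE_space
proof eventually_elim
  case (elim \<omega>)
  then show ?case
    using X_fejer[of \<omega> p 0] x0_near by (fastforce simp: dist_commute intro: order_trans)
qed

lemma sum_nn_integral_msd_le:
  "(\<Sum>n<N. ennreal (lam n * (1 - lam n)) * (\<integral>\<^sup>+\<omega>. msd (X n \<omega>) \<partial>M)) \<le> ennreal (c\<^sup>2)"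
proof -
  let ?d = "\<lambda>n \<omega>. (dist (X n \<omega>) (T (vs n \<omega>) (X n \<omega>)))\<^sup>2"
  have "(\<Sum>n<N. ennreal (lam n * (1 - lam n)) * (\<integral>\<^sup>+\<omega>. msd (X n \<omega>) \<partial>M))
      = (\<integral>\<^sup>+\<omega>. (\<Sum>n<N. ennreal (lam n * (1 - lam n)) * ennreal (?d n \<omega>)) \<partial>M)"
    by (simp add: nn_integral_sum nn_integral_cmult nn_integral_displacement_eq_msd)
  also have "\<dots> \<le> (\<integral>\<^sup>+\<omega>. ennreal (c\<^sup>2) \<partial>M)"
  proof (rule nn_integral_mono_AE)
    show "AE \<omega> in M. (\<Sum>n<N. ennreal (lam n * (1 - lam n)) * ennreal (?d n \<omega>)) \<le> ennreal (c\<^sup>2)"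
      using AE_vs_fixed[OF p_fixed] AE_space
    proof eventually_elim
      case (elim \<omega>)
      have "(\<Sum>n<N. lam n * (1 - lam n) * ?d n \<omega>) \<le> (dist x0 p)\<^sup>2"
        by (rule order_trans[OF _ sum_displacement_le[of \<omega> N]]) (use elim in auto)
      also have "\<dots> \<le> c\<^sup>2"
        using x0_near by (intro power_mono) auto
      finally show ?case
        using lam_01 by (simp add: ennreal_mult[symmetric] ennreal_leI)
    qed
  qed
  also have "\<dots> = ennreal (c\<^sup>2)" by (simp add: emeasure_space_1)
  finally show ?thesis .
qed

section \<open>Almost sure convergence\<close>

text \<open>The series \<open>\<Sum> \<lambda>\<^sub>n (1 - \<lambda>\<^sub>n) \<phi>(x\<^sub>n)\<close> has finite expectation, so it converges almost surely; with
  \<open>\<phi>(x\<^sub>n)\<close> bounded away from \<open>0\<close> from some index on, it would diverge with \<open>\<Sum> \<lambda>\<^sub>n (1 - \<lambda>\<^sub>n)\<close>.\<close>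

lemma AE_msd_frequently_small:
  assumes div: "filterlim (\<lambda>N. \<Sum>n<N. lam n * (1 - lam n)) at_top sequentially"
  shows "AE \<omega> in M. \<forall>e>0. \<forall>N. \<exists>n\<ge>N. msd (X n \<omega>) < ennreal e"
proof -
  let ?a = "\<lambda>n. lam n * (1 - lam n)"
  let ?S = "\<lambda>\<omega>. \<Sum>n. ennreal (?a n) * msd (X n \<omega>)"
  have "(\<integral>\<^sup>+\<omega>. ?S \<omega> \<partial>M) = (\<Sum>n. ennreal (?a n) * (\<integral>\<^sup>+\<omega>. msd (X n \<omega>) \<partial>M))"
    by (simp add: nn_integral_suminf nn_integral_cmult)
  also have "\<dots> \<le> ennreal (c\<^sup>2)"
    unfolding suminf_eq_SUP by (intro SUP_least sum_nn_integral_msd_le)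
  finally have "(\<integral>\<^sup>+\<omega>. ?S \<omega> \<partial>M) \<noteq> \<infinity>"
    by (auto simp: top_unique)
  then have "AE \<omega> in M. ?S \<omega> \<noteq> \<infinity>"
    by (intro nn_integral_PInf_AE) measurable
  then show ?thesis
  proof eventually_elim
    case (elim \<omega>)
    show ?case
    proof (intro allI impI, rule ccontr)
      fix e :: real and N :: nat
      assume e: "0 < e" and "\<not> (\<exists>n\<ge>N. msd (X n \<omega>) < ennreal e)"
      then have large: "ennreal e \<le> msd (X n \<omega>)" if "N \<le> n" for n
        using that by (meson not_le)
      obtain s where s: "0 \<le> s" "?S \<omega> = ennreal s"
        using elim by (cases "?S \<omega>") auto
      \<comment> \<open>With \<open>m\<close> this large, the terms from \<open>N\<close> to \<open>m\<close> alone contribute \<open>s + 1\<close>, more than the total \<open>s\<close>.\<close>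
      have "\<forall>\<^sub>F m in sequentially. (\<Sum>n<N. ?a n) + (s + 1) / e \<le> (\<Sum>n<m. ?a n)"
        using div by (simp add: filterlim_at_top)
      then obtain m where m: "N \<le> m" "(\<Sum>n<N. ?a n) + (s + 1) / e \<le> (\<Sum>n<m. ?a n)"
        using eventually_ge_at_top[of N] by (metis (mono_tags, lifting) eventually_at_top_linorder nat_le_linear)
      have "(\<Sum>n<m. ?a n) = (\<Sum>n<N. ?a n) + (\<Sum>n=N..<m. ?a n)"
        using m(1) by (metis atLeast0LessThan le0 sum.atLeastLessThan_concat)
      with m(2) e have "s + 1 \<le> (\<Sum>n=N..<m. ?a n) * e"
        by (simp add: pos_divide_le_eq)
      then have "ennreal (s + 1) \<le> ennreal ((\<Sum>n=N..<m. ?a n) * e)"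
        by (rule ennreal_leI)
      also have "\<dots> = (\<Sum>n=N..<m. ennreal (?a n) * ennreal e)"
        using e lam_01(3) by (simp add: sum_distrib_right ennreal_mult[symmetric])
      also have "\<dots> \<le> (\<Sum>n=N..<m. ennreal (?a n) * msd (X n \<omega>))"
        by (intro sum_mono mult_left_mono large) auto
      also have "\<dots> \<le> (\<Sum>n<m. ennreal (?a n) * msd (X n \<omega>))"
        by (intro sum_mono2) auto
      also have "\<dots> \<le> ?S \<omega>"
        by (intro sum_le_suminf) auto
      finally show False
        using s by simp
    qed
  qed
qed

text \<open>On one sample path.  A cluster point \<open>q\<close> along which \<open>\<phi>\<close> tends to \<open>0\<close> is a random fixed
  point.  The path need not be Fejer monotone with respect to \<open>q\<close>, because the sampled mappings are
  known to fix only the points of \<open>D\<close>; but a point \<open>z \<in> D\<close> within \<open>e/3\<close> of \<open>q\<close> does as well, at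
  the cost of two further triangle inequalities.\<close>

lemma converges_to_random_fixed_point:
  assumes \<omega>: "\<omega> \<in> space M"
    and D: "D \<subseteq> random_fixed_points M T v" "random_fixed_points M T v \<subseteq> closure D"
    and fixed: "\<And>z n. z \<in> D \<Longrightarrow> T (vs n \<omega>) z = z"
    and bounded: "\<And>n. X n \<omega> \<in> cball p c"
    and small: "\<And>e N. 0 < e \<Longrightarrow> \<exists>n\<ge>N. msd (X n \<omega>) < ennreal e"
  shows "\<exists>q\<in>random_fixed_points M T v. (\<lambda>n. X n \<omega>) \<longlonglongrightarrow> q"
proof -
  have "\<exists>n\<ge>i. msd (X n \<omega>) < ennreal (1 / real (Suc i))" for i
    by (rule small) simp
  then obtain s where s: "\<And>i. i \<le> s i" "\<And>i. msd (X (s i) \<omega>) < ennreal (1 / real (Suc i))"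
    by metis
  have "seq_compact (cball p c)"
    using compact_cball_proper[of p c] compact_imp_seq_compact by blast
  then obtain q r where r: "strict_mono r" and q: "((\<lambda>i. X (s i) \<omega>) \<circ> r) \<longlonglongrightarrow> q"
    using bounded unfolding seq_compact_def by meson
  have r_ge: "i \<le> r i" for i using r by (rule seq_suble)
  have msd_q: "msd q \<le> ennreal (2 / real (Suc i) + 8 * (dist (X (s (r i)) \<omega>) q)\<^sup>2)" for i
  proof -
    have "msd (X (s (r i)) \<omega>) \<le> ennreal (1 / real (Suc (r i)))"
      using s(2) by (rule less_imp_le)
    also have "\<dots> \<le> ennreal (1 / real (Suc i))"
      using r_ge[of i] by (intro ennreal_leI divide_left_mono) auto
    finally have "2 * msd (X (s (r i)) \<omega>) + ennreal (8 * (dist (X (s (r i)) \<omega>) q)\<^sup>2)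
        \<le> 2 * ennreal (1 / real (Suc i)) + ennreal (8 * (dist (X (s (r i)) \<omega>) q)\<^sup>2)"
      by (intro add_mono mult_left_mono order_refl) simp_all
    with msd_le_of_close
    have "msd q \<le> 2 * ennreal (1 / real (Suc i)) + ennreal (8 * (dist (X (s (r i)) \<omega>) q)\<^sup>2)"
      by (rule order_trans)
    also have "2 * ennreal (1 / real (Suc i)) = ennreal (2 * (1 / real (Suc i)))"
      by (subst ennreal_mult) auto
    finally show ?thesis
      by (subst ennreal_plus) auto
  qed
  have "(\<lambda>i. dist (X (s (r i)) \<omega>) q) \<longlonglongrightarrow> 0"
    using q by (subst (asm) tendsto_dist_iff) (simp add: o_def)
  then have "(\<lambda>i. 2 / real (Suc i) + 8 * (dist (X (s (r i)) \<omega>) q)\<^sup>2) \<longlonglongrightarrow> 0 + 8 * 0\<^sup>2"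
    using LIMSEQ_Suc[OF lim_const_over_n[of 2]] by (intro tendsto_add tendsto_mult tendsto_const tendsto_power) simp_all
  then have "(\<lambda>i. ennreal (2 / real (Suc i) + 8 * (dist (X (s (r i)) \<omega>) q)\<^sup>2)) \<longlonglongrightarrow> ennreal 0"
    by (intro tendsto_ennrealI) simp
  then have "msd q \<le> 0"
    using msd_q by (intro LIMSEQ_le_const) auto
  then have q_fixed: "q \<in> random_fixed_points M T v"
    by (simp add: random_fixed_point_iff_msd)
  have "(\<lambda>n. X n \<omega>) \<longlonglongrightarrow> q"
  proof (rule metric_LIMSEQ_I)
    fix e :: real assume "0 < e"
    then have e: "0 < e / 3" by simp
    obtain z where z: "z \<in> D" "dist z q < e / 3"
      using q_fixed D(2) e by (meson closure_approachable subsetD)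
    obtain i where i: "dist (X (s (r i)) \<omega>) q < e / 3"
      using metric_LIMSEQ_D[OF q e] by auto
    have "dist (X n \<omega>) q < e" if "s (r i) \<le> n" for n
    proof -
      have "dist (X n \<omega>) z \<le> dist (X (s (r i)) \<omega>) z"
        using X_fejer[OF \<omega> fixed[OF z(1)] that] .
      then show ?thesis
        using z(2) i dist_triangle[of "X n \<omega>" q z] dist_triangle[of "X (s (r i)) \<omega>" z q]
        by (simp add: dist_commute)
    qed
    then show "\<exists>n0. \<forall>n\<ge>n0. dist (X n \<omega>) q < e" by blast
  qed
  with q_fixed show ?thesis by blast
qed

proposition almost_sure_convergence:
  assumes div: "filterlim (\<lambda>N. \<Sum>n<N. lam n * (1 - lam n)) at_top sequentially"
  shows "\<exists>x. x \<in> borel_measurable M \<and> (AE \<omega> in M. (\<lambda>n. X n \<omega>) \<longlonglongrightarrow> x \<omega>) \<and>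
    (AE \<omega> in M. x \<omega> \<in> random_fixed_points M T v)"
proof -
  obtain D where D: "countable D" "D \<subseteq> random_fixed_points M T v"
      "random_fixed_points M T v \<subseteq> closure D"
    by (rule separable)
  have "AE \<omega> in M. \<forall>z\<in>D. \<forall>n. T (vs n \<omega>) z = z"
    using D(1,2) AE_vs_fixed by (subst AE_ball_countable) auto
  then have "AE \<omega> in M. \<exists>q\<in>random_fixed_points M T v. (\<lambda>n. X n \<omega>) \<longlonglongrightarrow> q"
    using AE_X_in_cball AE_msd_frequently_small[OF div] AE_space
  proof eventually_elim
    case (elim \<omega>)
    then show ?case
      by (intro converges_to_random_fixed_point[OF _ D(2,3)]) auto
  qed
  then obtain N where N: "N \<in> sets M" "emeasure M N = 0"
      "{\<omega> \<in> space M. \<not> (\<exists>q\<in>random_fixed_points M T v. (\<lambda>n. X n \<omega>) \<longlonglongrightarrow> q)} \<subseteq> N"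
    by (rule AE_E) blast
  \<comment> \<open>On the null set \<open>N\<close> the path may diverge; a constant value there makes \<open>x\<close> an everywhere
    pointwise limit of measurable functions.\<close>
  define x where "x \<omega> = (if \<omega> \<in> N then p else lim (\<lambda>n. X n \<omega>))" for \<omega>
  have lim: "(\<lambda>n. X n \<omega>) \<longlonglongrightarrow> x \<omega> \<and> x \<omega> \<in> random_fixed_points M T v"
    if "\<omega> \<in> space M" "\<omega> \<notin> N" for \<omega>
    using that N(3) unfolding x_def by (auto simp: limI)
  have "x \<in> borel_measurable M"
  proof (rule borel_measurable_LIMSEQ_metric)
    show "(\<lambda>\<omega>. if \<omega> \<in> N then p else X n \<omega>) \<in> borel_measurable M" for n
      using N(1) by measurable
    show "(\<lambda>n. if \<omega> \<in> N then p else X n \<omega>) \<longlonglongrightarrow> x \<omega>" if "\<omega> \<in> space M" for \<omega>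
      using lim[OF that] by (cases "\<omega> \<in> N") (auto simp: x_def)
  qed
  moreover have "AE \<omega> in M. \<omega> \<notin> N"
    using N(1,2) by (intro AE_not_in) auto
  then have "AE \<omega> in M. (\<lambda>n. X n \<omega>) \<longlonglongrightarrow> x \<omega> \<and> x \<omega> \<in> random_fixed_points M T v"
    using AE_space by eventually_elim (use lim in blast)
  ultimately show ?thesis by auto
qed

section \<open>The rate of metastability\<close>

text \<open>If \<open>E \<phi>(x\<^sub>n) > \<mu>\<close> held up to the index \<open>\<theta>(0, c\<^sup>2/\<mu>)\<close>, where the weights \<open>\<lambda>\<^sub>n (1 - \<lambda>\<^sub>n)\<close> have sum
  at least \<open>c\<^sup>2/\<mu>\<close>, the weighted sum of these expectations would exceed \<open>c\<^sup>2\<close>.\<close>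

lemma exists_small_msd_stage:
  assumes \<theta>: "rate_of_divergence (\<lambda>n. lam n * (1 - lam n)) \<theta>" and c: "0 < c" and \<mu>: "0 < \<mu>"
  shows "\<exists>m\<le>\<theta> 0 (c\<^sup>2 / \<mu>). (\<integral>\<^sup>+\<omega>. msd (X m \<omega>) \<partial>M) \<le> ennreal \<mu>"
proof (rule ccontr)
  let ?a = "\<lambda>n. lam n * (1 - lam n)" and ?I = "\<lambda>n. \<integral>\<^sup>+\<omega>. msd (X n \<omega>) \<partial>M"
  let ?N = "\<theta> 0 (c\<^sup>2 / \<mu>)"
  assume "\<not> ?thesis"
  then have "ennreal \<mu> < ?I n" if "n \<le> ?N" for n
    using that by (meson not_le)
  then have "ennreal \<mu> < Min (?I ` {..?N})"
    by (subst Min_gr_iff) auto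
  \<comment> \<open>A uniform real bound \<open>r > \<mu>\<close> reduces the contradiction to a strict inequality between reals.\<close>
  then obtain z where z: "ennreal \<mu> < z" "z < Min (?I ` {..?N})"
    using dense by blast
  then obtain r where r: "z = ennreal r" "0 \<le> r"
    by (cases z) auto
  have \<mu>r: "\<mu> < r" using z(1) r \<mu> by (simp add: ennreal_less_iff)
  have "c\<^sup>2 / \<mu> \<le> (\<Sum>n=0..?N. ?a n)"
    using \<theta> c \<mu> unfolding rate_of_divergence_def by simp
  then have s: "c\<^sup>2 / \<mu> \<le> (\<Sum>n<Suc ?N. ?a n)"
    by (simp add: atLeast0AtMost lessThan_Suc_atMost)
  have "ennreal ((\<Sum>n<Suc ?N. ?a n) * r) = (\<Sum>n<Suc ?N. ennreal (?a n) * ennreal r)"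
    using r(2) lam_01(3) by (simp add: sum_distrib_right ennreal_mult[symmetric] del: sum.lessThan_Suc)
  also have "\<dots> \<le> (\<Sum>n<Suc ?N. ennreal (?a n) * ?I n)"
  proof (intro sum_mono mult_left_mono)
    fix n assume "n \<in> {..<Suc ?N}"
    then have "Min (?I ` {..?N}) \<le> ?I n" by (intro Min_le) auto
    then show "ennreal r \<le> ?I n" using z(2) r(1) by order
  qed simp
  also have "\<dots> \<le> ennreal (c\<^sup>2)" by (rule sum_nn_integral_msd_le)
  finally have "(\<Sum>n<Suc ?N. ?a n) * r \<le> c\<^sup>2" by simp
  moreover have "c\<^sup>2 / \<mu> * r \<le> (\<Sum>n<Suc ?N. ?a n) * r"
    using s r(2) by (rule mult_right_mono)
  moreover have "c\<^sup>2 < c\<^sup>2 / \<mu> * r"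
    using \<mu>r \<mu> c by (simp add: field_simps)
  ultimately show False by simp
qed

text \<open>The displacements of the random point \<open>x\<^sub>m\<close> by samples \<open>v\<^sub>l\<close> with \<open>l < m\<close> are not controlled by
  \<open>\<phi>(x\<^sub>m)\<close>, since these samples have shaped \<open>x\<^sub>m\<close>.  For each deterministic \<open>y\<close> with
  \<open>\<phi>(y) \<le> e\<^sup>2\<close>, however, the sum of the first \<open>R\<close> displacements has expectation at most \<open>R e\<close>.
  The union bound over a maximal \<open>\<delta>\<close>-separated set of such \<open>y\<close>, of at most \<open>K\<close> points, covers all
  possible positions of \<open>x\<^sub>m\<close> at once; one half of the exceptional probability \<open>2\<eta>\<close> is spent on
  this and the other half on \<open>\<phi>(x\<^sub>m) > e\<^sup>2\<close>.\<close>

lemma anchor_off_small_event: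
  assumes \<eta>: "0 < \<eta>" and \<delta>: "0 < \<delta>"
    and e: "e = \<eta> * \<delta> / ((real K + 1) * (real R + 1))"
    and stage: "(\<integral>\<^sup>+\<omega>. msd (X m \<omega>) \<partial>M) \<le> ennreal (\<eta> * e\<^sup>2)"
    and card: "\<And>S. finite S \<Longrightarrow> S \<subseteq> cball p c \<Longrightarrow>
      (\<And>x y. x \<in> S \<Longrightarrow> y \<in> S \<Longrightarrow> x \<noteq> y \<Longrightarrow> \<delta> < dist x y) \<Longrightarrow> card S \<le> K"
  shows "\<exists>Bad\<in>events. prob Bad \<le> 2 * \<eta> \<and>
    (\<forall>\<omega>\<in>space M - Bad. X m \<omega> \<in> cball p c \<longrightarrow>
      (\<exists>y. dist (X m \<omega>) y \<le> \<delta> \<and> (\<Sum>l<R. dist y (T (vs l \<omega>) y)) \<le> \<delta>))"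
proof -
  have e_pos: "0 < e" using \<eta> \<delta> e by simp
  define W where "W = {y \<in> cball p c. msd y \<le> ennreal (e\<^sup>2)}"
  obtain S where S: "finite S" "S \<subseteq> W" "card S \<le> K" "\<And>w. w \<in> W \<Longrightarrow> \<exists>y\<in>S. dist w y \<le> \<delta>"
  proof (rule maximal_separated_subset[of \<delta> W K])
    show "0 \<le> \<delta>" using \<delta> by simp
    show "card S \<le> K" if "finite S" "S \<subseteq> W"
      "\<And>x y. x \<in> S \<Longrightarrow> y \<in> S \<Longrightarrow> x \<noteq> y \<Longrightarrow> \<delta> < dist x y" for S
      using that by (intro card) (auto simp: W_def)
  qed blast
  define Bad0 where "Bad0 = {\<omega> \<in> space M. ennreal (e\<^sup>2) < msd (X m \<omega>)}"
  define Bad1 where "Bad1 y = {\<omega> \<in> space M. ennreal \<delta> < ennreal (\<Sum>l<R. dist y (T (vs l \<omega>) y))}" for y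
  have Bad0[measurable]: "Bad0 \<in> events" and Bad1[measurable]: "Bad1 y \<in> events" for y
    unfolding Bad0_def Bad1_def by measurable
  have "prob Bad0 \<le> \<eta>"
    unfolding Bad0_def using \<eta> e_pos stage by (intro prob_greater_le_of_nn_integral_le) auto
  moreover have "prob (Bad1 y) \<le> \<eta> / (real K + 1)" if y: "y \<in> S" for y
    unfolding Bad1_def
  proof (rule prob_greater_le_of_nn_integral_le)
    have "(\<integral>\<^sup>+\<omega>. ennreal (\<Sum>l<R. dist y (T (vs l \<omega>) y)) \<partial>M)
        = (\<Sum>l<R. \<integral>\<^sup>+\<omega>. ennreal (dist y (T (vs l \<omega>) y)) \<partial>M)"
      by (simp add: sum_ennreal[symmetric] nn_integral_sum del: sum_ennreal)
    also have "\<dots> = (\<Sum>l<R. \<integral>\<^sup>+u. ennreal (dist y (T u y)) \<partial>law)"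
      by (intro sum.cong refl nn_integral_vs) measurable
    also have "\<dots> \<le> (\<Sum>l<R. ennreal e)"
      using y S(2) by (intro sum_mono mean_displacement_le[OF e_pos]) (auto simp: W_def)
    also have "\<dots> = ennreal (real R * e)"
      using e_pos by (simp add: ennreal_mult ennreal_of_nat_eq_real_of_nat)
    also have "\<dots> \<le> ennreal (\<eta> / (real K + 1) * \<delta>)"
    proof (rule ennreal_leI)
      have "real R * e \<le> (real R + 1) * e" using e_pos by simp
      also have "\<dots> = \<eta> / (real K + 1) * \<delta>" 
        unfolding e by (simp add: divide_simps add_nonneg_eq_0_iff)
      finally show "real R * e \<le> \<eta> / (real K + 1) * \<delta>" .
    qed
    finally show "(\<integral>\<^sup>+\<omega>. ennreal (\<Sum>l<R. dist y (T (vs l \<omega>) y)) \<partial>M) \<le> ennreal (\<eta> / (real K + 1) * \<delta>)" .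
  qed (use \<eta> \<delta> in \<open>auto simp del: sum_ennreal\<close>)
  then have "prob (\<Union>y\<in>S. Bad1 y) \<le> (\<Sum>y\<in>S. \<eta> / (real K + 1))"
    by (intro order_trans[OF measure_UNION_le[OF S(1) Bad1] sum_mono])
  moreover have "(\<Sum>y\<in>S. \<eta> / (real K + 1)) \<le> \<eta>"
    using mult_right_mono[of "real (card S)" "real K + 1" \<eta>] S(3) \<eta>
    by (simp add: pos_divide_le_eq mult.commute)
  moreover have Union: "(\<Union>y\<in>S. Bad1 y) \<in> events"
    using S(1) Bad1 by (intro sets.finite_UN) auto
  ultimately have "prob (Bad0 \<union> (\<Union>y\<in>S. Bad1 y)) \<le> 2 * \<eta>"
    using measure_Un_le[OF Bad0 Union] by linarith
  moreover have "\<exists>y. dist (X m \<omega>) y \<le> \<delta> \<and> (\<Sum>l<R. dist y (T (vs l \<omega>) y)) \<le> \<delta>"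
    if \<omega>: "\<omega> \<in> space M - (Bad0 \<union> (\<Union>y\<in>S. Bad1 y))" "X m \<omega> \<in> cball p c" for \<omega>
  proof -
    have "X m \<omega> \<in> W" using \<omega> by (auto simp: Bad0_def W_def not_less)
    then obtain y where y: "y \<in> S" "dist (X m \<omega>) y \<le> \<delta>" using S(4) by blast
    then have "\<not> ennreal \<delta> < ennreal (\<Sum>l<R. dist y (T (vs l \<omega>) y))"
      using \<omega>(1) unfolding Bad1_def by blast
    then have "(\<Sum>l<R. dist y (T (vs l \<omega>) y)) \<le> \<delta>"
      using \<delta> by (simp add: not_less sum_nonneg)
    with y show ?thesis by blast
  qed
  ultimately show ?thesis
    using Bad0 Union by (intro bexI[of _ "Bad0 \<union> (\<Union>y\<in>S. Bad1 y)"]) blast+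
qed

text \<open>Among the \<open>K + 1\<close> stages \<open>m\<^sub>0, \<dots>, m\<^sub>K\<close> of small mean displacement, two are \<open>\<delta>\<close>-close, say
  \<open>m\<^sub>i\<close> and \<open>m\<^sub>j\<close> with \<open>i < j\<close>.  The horizon \<open>R\<^sub>j\<close> of the anchor \<open>y\<close> of stage \<open>j\<close> was fixed after
  \<open>m\<^sub>i\<close> was bounded, and so it contains all of \<open>[m\<^sub>i; m\<^sub>i + g(m\<^sub>i)]\<close>.  On this interval the sequence is within
  \<open>3\<delta>\<close> of \<open>y\<close>: one \<open>\<delta>\<close> each for the distance between the stages, the distance to the anchor, and
  the drift.\<close>

proposition metastability:
  assumes c: "0 < c"
    and \<gamma>: "modulus_total_boundedness (cball p c) \<gamma>"
    and \<theta>: "rate_of_divergence (\<lambda>n. lam n * (1 - lam n)) \<theta>"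
  shows "rate_of_metastability M X (explicit_metastability_rate c \<gamma> \<theta>)"
  unfolding rate_of_metastability_def Let_def
proof (intro allI impI conjI)
  fix \<epsilon> :: real and k :: nat and g :: "nat \<Rightarrow> nat"
  assume \<epsilon>: "0 < \<epsilon>"
  let ?\<Delta> = "explicit_metastability_rate c \<gamma> \<theta> \<epsilon> k g"
  let ?E = "{\<omega> \<in> space M. \<forall>n\<le>?\<Delta>. \<exists>i\<in>{n..n + g n}. \<exists>j\<in>{n..n + g n}.
      1 / (real k + 1) < dist (X i \<omega>) (X j \<omega>)}"
  show E: "?E \<in> events" by measurable
  define K where "K = \<gamma> (8 * k + 7)"
  define \<delta> where "\<delta> = 1 / (8 * (real k + 1))"
  define B where "B = metastability_stage c K \<delta> \<theta> \<epsilon> g"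
  define R where "R j = B j + Max (g ` {..B j})" for j
  define \<eta> where "\<eta> = \<epsilon> / (4 * (real K + 1))"
  define e where "e j = \<eta> * \<delta> / ((real K + 1) * (real (R j) + 1))" for j
  have \<delta>: "0 < \<delta>" "1 / (real (8 * k + 7) + 1) = \<delta>" "1 / (real k + 1) = 8 * \<delta>"
    unfolding \<delta>_def by (simp_all add: field_simps)
  have \<eta>: "0 < \<eta>" using \<epsilon> by (simp add: \<eta>_def)
  have e_pos: "0 < e j" for j using \<eta> \<delta>(1) by (simp add: e_def)
  have B_Suc: "B (Suc j) = max (B j) (\<theta> 0 (c\<^sup>2 / (\<eta> * (e j)\<^sup>2)))" for j
  proof -
    have "\<epsilon> * \<delta> / (4 * (real K + 1)\<^sup>2 * (real (R j) + 1)) = e j"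
      unfolding e_def \<eta>_def by (simp add: field_simps power2_eq_square)
    moreover have "\<epsilon> * (e j)\<^sup>2 / (4 * (real K + 1)) = \<eta> * (e j)\<^sup>2"
      by (simp add: \<eta>_def)
    moreover have "B (Suc j) = max (B j) (\<theta> 0 (c\<^sup>2 / (\<epsilon> *
        (\<epsilon> * \<delta> / (4 * (real K + 1)\<^sup>2 * (real (R j) + 1)))\<^sup>2 / (4 * (real K + 1)))))"
      unfolding B_def R_def by (simp only: metastability_stage.simps Let_def)
    ultimately show ?thesis by simp
  qed
  have \<Delta>: "?\<Delta> = B (Suc K)"
    unfolding explicit_metastability_rate_def Let_def B_def K_def \<delta>_def ..
  have "incseq B" by (rule incseq_SucI) (simp add: B_Suc)
  then have B_mono: "B i \<le> B j" if "i \<le> j" for i j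
    using that by (simp add: incseq_def)
  have "\<exists>m\<le>B (Suc j). (\<integral>\<^sup>+\<omega>. msd (X m \<omega>) \<partial>M) \<le> ennreal (\<eta> * (e j)\<^sup>2)" for j
    using exists_small_msd_stage[OF \<theta> c, of "\<eta> * (e j)\<^sup>2"] \<eta> e_pos[of j] unfolding B_Suc
    by (metis le_max_iff_disj mult_pos_pos zero_less_power)
  then obtain m where m: "\<And>j. m j \<le> B (Suc j)"
      "\<And>j. (\<integral>\<^sup>+\<omega>. msd (X (m j) \<omega>) \<partial>M) \<le> ennreal (\<eta> * (e j)\<^sup>2)"
    by metis
  have card: "card S \<le> K" if "finite S" "S \<subseteq> cball p c"
      "\<And>x y. x \<in> S \<Longrightarrow> y \<in> S \<Longrightarrow> x \<noteq> y \<Longrightarrow> \<delta> < dist x y" for S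
    unfolding K_def
    by (rule modulus_total_boundedness_card_separated[OF \<gamma> that(1,2)])
      (unfold \<delta>(2), rule that(3))
  have "\<exists>Bad\<in>events. prob Bad \<le> 2 * \<eta> \<and>
      (\<forall>\<omega>\<in>space M - Bad. X (m j) \<omega> \<in> cball p c \<longrightarrow>
        (\<exists>y. dist (X (m j) \<omega>) y \<le> \<delta> \<and> (\<Sum>l<R j. dist y (T (vs l \<omega>) y)) \<le> \<delta>))" for j
    using \<eta> \<delta>(1) e_def m(2) card by (rule anchor_off_small_event)
  then obtain Bad where Bad: "\<And>j. Bad j \<in> events" "\<And>j. prob (Bad j) \<le> 2 * \<eta>"
      "\<And>j \<omega>. \<omega> \<in> space M \<Longrightarrow> \<omega> \<notin> Bad j \<Longrightarrow> X (m j) \<omega> \<in> cball p c \<Longrightarrow>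
        \<exists>y. dist (X (m j) \<omega>) y \<le> \<delta> \<and> (\<Sum>l<R j. dist y (T (vs l \<omega>) y)) \<le> \<delta>"
    by (metis DiffI)
  \<comment> \<open>Outside the exceptional events of all \<open>K + 1\<close> stages, the interval starting at \<open>m i\<close> is stable.\<close>
  have stable: "\<omega> \<in> (\<Union>j\<le>K. Bad j)" if \<omega>: "\<omega> \<in> ?E" "\<forall>n. X n \<omega> \<in> cball p c" for \<omega>
  proof (rule ccontr)
    assume good: "\<omega> \<notin> (\<Union>j\<le>K. Bad j)"
    have \<omega>_space: "\<omega> \<in> space M" using \<omega>(1) by simp
    have "\<forall>n. X (m n) \<omega> \<in> cball p c" using \<omega>(2) by blast
    then obtain i j where ij: "i < j" "j \<le> K" "dist (X (m i) \<omega>) (X (m j) \<omega>) \<le> \<delta>"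
      using \<gamma>[unfolded modulus_total_boundedness_def, rule_format, of "\<lambda>n. X (m n) \<omega>" "8 * k + 7"]
      unfolding \<delta>(2) K_def by blast
    obtain y where y: "dist (X (m j) \<omega>) y \<le> \<delta>" "(\<Sum>l<R j. dist y (T (vs l \<omega>) y)) \<le> \<delta>"
      using Bad(3)[OF \<omega>_space, of j] good ij(2) \<omega>(2) by blast
    have mB: "m i \<le> B j"
      using m(1)[of i] B_mono[of "Suc i" j] ij(1) by simp
    have near: "dist (X n \<omega>) y \<le> 3 * \<delta>" if n: "n \<in> {m i..m i + g (m i)}" for n
    proof -
      have "g (m i) \<le> Max (g ` {..B j})" using mB by (intro Max_ge) auto
      then have "n \<le> R j" using n mB unfolding R_def atLeastAtMost_iff by linarith
      then have "(\<Sum>l<n. dist y (T (vs l \<omega>) y)) \<le> (\<Sum>l<R j. dist y (T (vs l \<omega>) y))"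
        by (intro sum_mono2) auto
      moreover have "dist (X n \<omega>) y \<le> dist (X (m i) \<omega>) y + (\<Sum>l<n. dist y (T (vs l \<omega>) y))"
        using X_dist_le_drift[OF \<omega>_space, of "m i" "n - m i" y] n by simp
      ultimately show ?thesis
        using y ij(3) dist_triangle[of "X (m i) \<omega>" y "X (m j) \<omega>"] by simp
    qed
    have "m i \<le> ?\<Delta>"
      unfolding \<Delta> using mB B_mono[of j "Suc K"] ij(2) by simp
    then obtain a b where ab: "a \<in> {m i..m i + g (m i)}" "b \<in> {m i..m i + g (m i)}"
        "8 * \<delta> < dist (X a \<omega>) (X b \<omega>)"
      using \<omega>(1) unfolding \<delta>(3) by blast
    show False
      using near[OF ab(1)] near[OF ab(2)] ab(3) dist_triangle[of "X a \<omega>" "X b \<omega>" y] \<delta>(1)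
      by (simp add: dist_commute)
  qed
  have "prob ?E \<le> prob (\<Union>j\<le>K. Bad j)"
  proof (rule finite_measure_mono_AE)
    show "AE \<omega> in M. \<omega> \<in> ?E \<longrightarrow> \<omega> \<in> (\<Union>j\<le>K. Bad j)"
      using AE_X_in_cball by eventually_elim (use stable in blast)
  qed (use Bad(1) in auto)
  also have "\<dots> \<le> (\<Sum>j\<le>K. prob (Bad j))"
    using Bad(1) by (intro measure_UNION_le) auto
  also have "\<dots> \<le> (\<Sum>j\<le>K. 2 * \<eta>)"
    by (intro sum_mono Bad(2))
  \<comment> \<open>There are \<open>K + 1\<close> exceptional events of probability at most \<open>2\<eta> = \<epsilon> / (2(K + 1))\<close> each.\<close>
  also have "\<dots> = \<epsilon> / 2"
    unfolding \<eta>_def by (simp add: field_simps)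
  also have "\<dots> < \<epsilon>" using \<epsilon> by simp
  finally show "prob ?E < \<epsilon>" .
qed

end

section \<open>The convergence theorem\<close>

theorem theorem5p12:
  fixes M :: "'o measure" and V :: "'v measure"
    and T :: "'v \<Rightarrow> 'a::proper_hadamard_space \<Rightarrow> 'a"
    and v :: "'o \<Rightarrow> 'v" and vs :: "nat \<Rightarrow> 'o \<Rightarrow> 'v"
    and lam :: "nat \<Rightarrow> real" and x0 p :: 'a and c :: real
  assumes "prob_space M"
    and nonexpansive: "\<And>u y z. u \<in> space V \<Longrightarrow> dist (T u y) (T u z) \<le> dist y z"
    and T_measurable: "(\<lambda>(u, y). T u y) \<in> V \<Otimes>\<^sub>M borel \<rightarrow>\<^sub>M borel"
    and v_measurable: "v \<in> M \<rightarrow>\<^sub>M V"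
    and p_fixed: "p \<in> random_fixed_points M T v"
    and c: "c \<ge> 1" "dist x0 p \<le> c"
    and lam_range: "\<And>n. lam n \<in> {0<..1}"
    and lam_diverges: "filterlim (\<lambda>N. \<Sum>n<N. lam n * (1 - lam n)) at_top sequentially"
    and vs_measurable: "\<And>n. vs n \<in> M \<rightarrow>\<^sub>M V"
    and vs_indep: "prob_space.indep_vars M (\<lambda>_. V) vs UNIV"
    and vs_distr: "\<And>n. distr M V (vs n) = distr M V v"
  shows "(\<exists>x. x \<in> M \<rightarrow>\<^sub>M borel \<and>
            (AE \<omega> in M. (\<lambda>n. random_KM T vs lam x0 n \<omega>) \<longlonglongrightarrow> x \<omega>) \<and>
            (AE \<omega> in M. x \<omega> \<in> random_fixed_points M T v)) \<and>
         (\<forall>\<gamma> \<theta>. modulus_total_boundedness (cball p c) \<gamma> \<longrightarrow>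
                rate_of_divergence (\<lambda>n. lam n * (1 - lam n)) \<theta> \<longrightarrow>
                rate_of_metastability M (random_KM T vs lam x0)
                  (explicit_metastability_rate c \<gamma> \<theta>))"
proof -
  interpret prob_space M by fact
  interpret random_KM_iteration M V T v vs lam x0 p c
    by unfold_locales (fact | rule assms)+
  show ?thesis
  proof (intro conjI allI impI)
    show "\<exists>x. x \<in> M \<rightarrow>\<^sub>M borel \<and>
        (AE \<omega> in M. (\<lambda>n. random_KM T vs lam x0 n \<omega>) \<longlonglongrightarrow> x \<omega>) \<and>
        (AE \<omega> in M. x \<omega> \<in> random_fixed_points M T v)"
      by (rule almost_sure_convergence) fact
    show "rate_of_metastability M (random_KM T vs lam x0) (explicit_metastability_rate c \<gamma> \<theta>)"
      if "modulus_total_boundedness (cball p c) \<gamma>"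
        "rate_of_divergence (\<lambda>n. lam n * (1 - lam n)) \<theta>" for \<gamma> \<theta>
      using _ that by (rule metastability) (use c(1) in simp)
  qed
qed

end
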